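(* Let $m_1,m_2,m_3>0$. Each of the three families of balanced configurations (true triangles) has a cusp in the $(h,k)$ diagram, or it touches the maximum $k=1/4$, or both simultaneously.
   Context: Consider the Newtonian 3-body problem in $\mathbb{R}^4$ with gravitational constant 1. For a triangle with mutual distances $d_{ij}$ write $a=d_{23}^2$, $b=d_{13}^2$, $c=d_{12}^2$ $(>0)$. It is a true triangle if $2ab+2bc+2ca-a^2-b^2-c^2>0$ and flat if this expression is $0$. It is balanced if $B=0$, where $B$ is the determinant of the $3\times3$ matrix with rows $(1,1,1)$, $(m_1(b+c-a),m_2(c+a-b),m_3(a+b-c))$, $(a^{-3/2},b^{-3/2},c^{-3/2})$. Up to scaling, the set of balanced true triangles is the union of three smooth curves (the three families), whose six ends are the three collinear Euler configurations and the three points $[a,b,c]=[0,1,1],[1,0,1],[1,1,0]$. Each curve is parametrised by a smooth coordinate $s$ of the curve; a prime denotes $d/ds$. To a balanced true triangle of given size is associated a relative equilibrium as follows. Place the centre of mass at the origin of the plane of the triangle, with positions $\xi_i$; let $S=\sum_i m_i\xi_i\xi_i^t$ and let $W$ be the unique endomorphism of this plane with $-W\xi_i=\sum_{j\neq i}m_j(\xi_j-\xi_i)/|\xi_j-\xi_i|^3$. The triangle being balanced, $S$ and $W$ have a common orthonormal eigenbasis (the axes of inertia, chosen smoothly along the family) with eigenvalues $\Theta_1,\Theta_2$ of $S$ and $\omega_1^2,\omega_2^2$ of $W$, $\omega_i>0$. In $\mathbb{R}^4=\mathbb{R}^2\oplus\mathbb{R}^2$ the $i$-th axis lies in the $i$-th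 $\mathbb{R}^2$ and rotates uniformly in it with angular velocity $\omega_i$. The angular momentum has eigenvalues $\pm i\mu_1,\pm i\mu_2$ with $\mu_i=\Theta_i\omega_i$. With $H=\frac12(\Theta_1\omega_1^2+\Theta_2\omega_2^2)-\sum_{i<j}m_im_j/d_{ij}$ put $$h=H(\mu_1+\mu_2)^2,\qquad k=\frac{\mu_1\mu_2}{(\mu_1+\mu_2)^2}\le\tfrac14,$$ which are invariant under scaling of the triangle. The $(h,k)$ diagram is the image of the families under $(h,k)$. The family has a cusp at a parameter value where $(h',k')=(0,0)$ (even if $(h'',k'')=(0,0)$ as well). *)

theory Defs
  imports "HOL-Analysis.Analysis"
begin

text \<open>
  A triangle is a vector \<open>T\<close> with components \<open>T $ 1 = a\<close>, \<open>T $ 2 = b\<close>, \<open>T $ 3 = c\<close>, where \<open>T $ i\<close> is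
  the squared length of the side opposite to body \<open>i\<close>.
\<close>

definition true_triangle :: "real^3 \<Rightarrow> bool" where
  "true_triangle T \<longleftrightarrow>
     (let a = T $ 1; b = T $ 2; c = T $ 3 in
        0 < a \<and> 0 < b \<and> 0 < c \<and>
        0 < 2 * a * b + 2 * b * c + 2 * c * a - a^2 - b^2 - c^2)"

definition balance_det :: "(3 \<Rightarrow> real) \<Rightarrow> real^3 \<Rightarrow> real" where
  "balance_det m T =
     (let a = T $ 1; b = T $ 2; c = T $ 3 in
        det (vector
          [vector [1, 1, 1],
           vector [m 1 * (b + c - a), m 2 * (c + a - b), m 3 * (a + b - c)],
           vector [a powr (-3/2), b powr (-3/2), c powr (-3/2)]] :: real^3^3))"

definition balanced_true_triangle :: "(3 \<Rightarrow> real) \<Rightarrow> real^3 \<Rightarrow> bool" where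
  "balanced_true_triangle m T \<longleftrightarrow> true_triangle T \<and> balance_det m T = 0"

definition has_sides :: "(3 \<Rightarrow> 'a::metric_space) \<Rightarrow> real^3 \<Rightarrow> bool" where
  "has_sides \<xi> T \<longleftrightarrow>
     (dist (\<xi> 2) (\<xi> 3))^2 = T $ 1 \<and> (dist (\<xi> 1) (\<xi> 3))^2 = T $ 2 \<and> (dist (\<xi> 1) (\<xi> 2))^2 = T $ 3"

definition centred :: "(3 \<Rightarrow> real) \<Rightarrow> (3 \<Rightarrow> 'a::real_vector) \<Rightarrow> bool" where
  "centred m \<xi> \<longleftrightarrow> (\<Sum>i\<in>UNIV. m i *\<^sub>R \<xi> i) = 0"

definition acceleration :: "(3 \<Rightarrow> real) \<Rightarrow> (3 \<Rightarrow> 'a::real_normed_vector) \<Rightarrow> 3 \<Rightarrow> 'a" where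
  "acceleration m \<xi> i = (\<Sum>j\<in>UNIV - {i}. (m j / norm (\<xi> j - \<xi> i) ^ 3) *\<^sub>R (\<xi> j - \<xi> i))"

text \<open>Triangles up to scaling are represented by the triangles with \<open>a + b + c = 1\<close>.\<close>

definition unit_size :: "real^3 \<Rightarrow> real^3" where
  "unit_size T = (1 / (T $ 1 + T $ 2 + T $ 3)) *\<^sub>R T"

text \<open>An Euler configuration is a collisionless central configuration of the three bodies on a line.\<close>

definition euler_config :: "(3 \<Rightarrow> real) \<Rightarrow> real^3 \<Rightarrow> bool" where
  "euler_config m T \<longleftrightarrow>
     (\<exists>(x :: 3 \<Rightarrow> real) (\<kappa> :: real).
        inj x \<and> has_sides x T \<and> centred m x \<and> (\<forall>i. - (\<kappa> * x i) = acceleration m x i))"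

definition double_collisions :: "(real^3) set" where
  "double_collisions = {vector [0, 1, 1], vector [1, 0, 1], vector [1, 1, 0]}"

definition end_points :: "(3 \<Rightarrow> real) \<Rightarrow> (real^3) set" where
  "end_points m = unit_size ` ({T. euler_config m T} \<union> double_collisions)"

text \<open>Only used for open \<open>I\<close>; it then means \<open>C\<^sup>\<infinity>\<close> on \<open>I\<close>, with \<open>D n\<close> the derivative of order \<open>n\<close>.\<close>

definition smooth_on :: "real set \<Rightarrow> (real \<Rightarrow> 'a::real_normed_vector) \<Rightarrow> bool" where
  "smooth_on I f \<longleftrightarrow>
     (\<exists>D. D 0 = f \<and> (\<forall>n. \<forall>s\<in>I. (D n has_vector_derivative D (Suc n) s) (at s)))"

text \<open>
  A curve of triangles up to scaling, parametrised by a smooth coordinate \<open>s \<in> (0,1)\<close>. The size of the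
  triangle may vary arbitrarily (but smoothly) with \<open>s\<close>; regularity and injectivity concern the
  curve of triangles up to scaling.
\<close>

definition smooth_triangle_curve :: "(real \<Rightarrow> real^3) \<Rightarrow> bool" where
  "smooth_triangle_curve \<gamma> \<longleftrightarrow>
     smooth_on {0<..<1} \<gamma> \<and>
     inj_on (\<lambda>s. unit_size (\<gamma> s)) {0<..<1} \<and>
     (\<forall>s\<in>{0<..<1}. vector_derivative (\<lambda>s. unit_size (\<gamma> s)) (at s) \<noteq> 0)"

text \<open>
  \<open>E (j, False)\<close> and \<open>E (j, True)\<close> are the two ends of the \<open>j\<close>-th curve; bijectivity says that the
  six ends are exactly the three Euler configurations and the three double collisions.
\<close>

definition three_families :: "(3 \<Rightarrow> real) \<Rightarrow> (3 \<Rightarrow> real \<Rightarrow> real^3) \<Rightarrow> bool" where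
  "three_families m \<gamma> \<longleftrightarrow>
     (\<forall>j. smooth_triangle_curve (\<gamma> j)) \<and>
     (\<forall>T. balanced_true_triangle m T \<longleftrightarrow> (\<exists>j. \<exists>s\<in>{0<..<1}. \<exists>r>0. T = r *\<^sub>R \<gamma> j s)) \<and>
     (\<exists>E :: 3 \<times> bool \<Rightarrow> real^3.
        bij_betw E UNIV (end_points m) \<and>
        (\<forall>j. ((\<lambda>s. unit_size (\<gamma> j s)) \<longlongrightarrow> E (j, False)) (at_right 0) \<and>
             ((\<lambda>s. unit_size (\<gamma> j s)) \<longlongrightarrow> E (j, True)) (at_left 1)))"

definition inertia :: "(3 \<Rightarrow> real) \<Rightarrow> (3 \<Rightarrow> real^2) \<Rightarrow> real^2^2" where
  "inertia m \<xi> = (\<chi> p q. \<Sum>i\<in>UNIV. m i * \<xi> i $ p * \<xi> i $ q)"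

text \<open>
  The plane of the triangle is identified with \<open>real^2\<close>, and \<open>e 1\<close>, \<open>e 2\<close> are the axes of inertia.
\<close>

definition equilibrium_data ::
  "(3 \<Rightarrow> real) \<Rightarrow> real^3 \<Rightarrow> (3 \<Rightarrow> real^2) \<Rightarrow> (2 \<Rightarrow> real^2) \<Rightarrow> (2 \<Rightarrow> real) \<Rightarrow> (2 \<Rightarrow> real) \<Rightarrow> bool" where
  "equilibrium_data m T \<xi> e \<Theta> \<omega> \<longleftrightarrow>
     has_sides \<xi> T \<and> centred m \<xi> \<and>
     (\<forall>p q. e p \<bullet> e q = (if p = q then 1 else 0)) \<and>
     (\<forall>p. inertia m \<xi> *v e p = \<Theta> p *\<^sub>R e p) \<and>
     (\<exists>W :: real^2^2.
        (\<forall>i. - (W *v \<xi> i) = acceleration m \<xi> i) \<and>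
        (\<forall>p. 0 < \<omega> p \<and> W *v e p = (\<omega> p)^2 *\<^sub>R e p))"

text \<open>The placement of the triangle in its plane and the axes of inertia vary smoothly along a curve.\<close>

definition equilibria_along ::
  "(3 \<Rightarrow> real) \<Rightarrow> (real \<Rightarrow> real^3) \<Rightarrow> (real \<Rightarrow> 3 \<Rightarrow> real^2) \<Rightarrow> (real \<Rightarrow> 2 \<Rightarrow> real^2)
     \<Rightarrow> (real \<Rightarrow> 2 \<Rightarrow> real) \<Rightarrow> (real \<Rightarrow> 2 \<Rightarrow> real) \<Rightarrow> bool" where
  "equilibria_along m \<gamma> \<xi> e \<Theta> \<omega> \<longleftrightarrow>
     (\<forall>i. smooth_on {0<..<1} (\<lambda>s. \<xi> s i)) \<and>
     (\<forall>p. smooth_on {0<..<1} (\<lambda>s. e s p)) \<and>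
     (\<forall>s\<in>{0<..<1}. equilibrium_data m (\<gamma> s) (\<xi> s) (e s) (\<Theta> s) (\<omega> s))"

definition energy :: "(3 \<Rightarrow> real) \<Rightarrow> real^3 \<Rightarrow> (2 \<Rightarrow> real) \<Rightarrow> (2 \<Rightarrow> real) \<Rightarrow> real" where
  "energy m T \<Theta> \<omega> =
     1/2 * (\<Theta> 1 * (\<omega> 1)^2 + \<Theta> 2 * (\<omega> 2)^2)
     - (m 2 * m 3 / sqrt (T $ 1) + m 1 * m 3 / sqrt (T $ 2) + m 1 * m 2 / sqrt (T $ 3))"

definition h_value :: "(3 \<Rightarrow> real) \<Rightarrow> real^3 \<Rightarrow> (2 \<Rightarrow> real) \<Rightarrow> (2 \<Rightarrow> real) \<Rightarrow> real" where
  "h_value m T \<Theta> \<omega> =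
     (let \<mu> = (\<lambda>p. \<Theta> p * \<omega> p) in energy m T \<Theta> \<omega> * (\<mu> 1 + \<mu> 2)^2)"

definition k_value :: "(2 \<Rightarrow> real) \<Rightarrow> (2 \<Rightarrow> real) \<Rightarrow> real" where
  "k_value \<Theta> \<omega> =
     (let \<mu> = (\<lambda>p. \<Theta> p * \<omega> p) in \<mu> 1 * \<mu> 2 / (\<mu> 1 + \<mu> 2)^2)"

definition cusp_at :: "(real \<Rightarrow> real) \<Rightarrow> (real \<Rightarrow> real) \<Rightarrow> real \<Rightarrow> bool" where
  "cusp_at h k s \<longleftrightarrow> (h has_real_derivative 0) (at s) \<and> (k has_real_derivative 0) (at s)"

end

theory Submission
  imports Defs
begin

text \<open>
  Along a family, \<open>k\<close> is positive and tends to \<open>0\<close> at both ends, so it attains a maximum at an interior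
  parameter, where \<open>k' = 0\<close>. It remains to see that \<open>h' = 0\<close> there, unless \<open>\<mu>\<^sub>1 = \<mu>\<^sub>2\<close>, that is, unless
  \<open>k = 1/4\<close>.

  A relative equilibrium is a critical point of the energy when the angular momentum is prescribed, and this gives
  \<open>H' = \<omega>\<^sub>1 \<mu>\<^sub>1' + \<omega>\<^sub>2 \<mu>\<^sub>2'\<close> (lemma \<open>first_variation\<close>). The equation \<open>k' = 0\<close> reads
  \<open>(\<mu>\<^sub>2 - \<mu>\<^sub>1) (\<mu>\<^sub>1' \<mu>\<^sub>2 - \<mu>\<^sub>2' \<mu>\<^sub>1) = 0\<close>, so if \<open>\<mu>\<^sub>1 \<noteq> \<mu>\<^sub>2\<close> the two momenta vary with the same logarithmic rate
  \<open>c\<close>. Then \<open>H' = c (\<mu>\<^sub>1 \<omega>\<^sub>1 + \<mu>\<^sub>2 \<omega>\<^sub>2) = - 2 c H\<close> by the virial identity, which cancels the rate \<open>2 c\<close>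
  of \<open>(\<mu>\<^sub>1 + \<mu>\<^sub>2)\<^sup>2\<close> in \<open>h\<close> (lemma \<open>cusp_at_stationary_k\<close>).

  The limits of \<open>k\<close> at the ends need no case distinction between Euler configurations and double
  collisions: at every end the area of the triangle of unit size vanishes, and on unit size \<open>k\<^sup>4\<close> is bounded by a
  constant (depending on the masses) times the squared area (lemma \<open>k_value_bound\<close>). The delicate point is
  that near a double collision one frequency is unbounded. But the product \<open>\<Theta>\<^sub>1 \<omega>\<^sub>1\<^sup>2 \<Theta>\<^sub>2 \<omega>\<^sub>2\<^sup>2\<close> is the
  determinant of a sum of three matrices of rank one, so that each of its terms contains only two of the
  three factors \<open>d\<^sub>i\<^sub>j\<^sup>-\<^sup>3\<close>, and these are absorbed by powers of the area.
\<close>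

section \<open>A maximum inside the interval\<close>

lemma interior_maximum:
  fixes f :: "real \<Rightarrow> real"
  assumes cont: "continuous_on {0<..<1} f"
    and pos: "\<And>s. s \<in> {0<..<1} \<Longrightarrow> 0 < f s"
    and lim0: "(f \<longlongrightarrow> 0) (at_right 0)"
    and lim1: "(f \<longlongrightarrow> 0) (at_left 1)"
  shows "\<exists>s\<in>{0<..<1}. \<forall>t\<in>{0<..<1}. f t \<le> f s"
proof -
  have p: "0 < f (1/2)" by (rule pos) simp
  have "\<forall>\<^sub>F s in at_right 0. f s < f (1/2)"
    by (rule order_tendstoD(2)[OF lim0 p])
  then obtain b where b: "b > 0" "\<And>s. 0 < s \<Longrightarrow> s < b \<Longrightarrow> f s < f (1/2)"
    by (auto simp: eventually_at_right_field)
  have "\<forall>\<^sub>F s in at_left 1. f s < f (1/2)"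
    by (rule order_tendstoD(2)[OF lim1 p])
  then obtain c where c: "c < 1" "\<And>s. c < s \<Longrightarrow> s < 1 \<Longrightarrow> f s < f (1/2)"
    by (auto simp: eventually_at_left_field)
  define K where "K = {min b (1/2)..max c (1/2)}"
  have K: "K \<subseteq> {0<..<1}" "1/2 \<in> K" using b(1) c(1) by (auto simp: K_def)
  have "\<exists>s\<in>K. \<forall>t\<in>K. f t \<le> f s"
    by (rule continuous_attains_sup) (use K cont continuous_on_subset in \<open>auto simp: K_def\<close>)
  then obtain s where s: "s \<in> K" "\<And>t. t \<in> K \<Longrightarrow> f t \<le> f s" by blast
  have "f t \<le> f s" if t: "t \<in> {0<..<1}" for t
  proof (cases "t \<in> K")
    case False
    then have "f t < f (1/2)" using t b(2)[of t] c(2)[of t] by (auto simp: K_def)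
    then show ?thesis using s(2)[OF K(2)] by simp
  qed (use s in blast)
  then show ?thesis using s(1) K(1) by blast
qed

section \<open>The area of a triangle\<close>

text \<open>Heron's formula expresses sixteen times the squared area by the squared sides.\<close>

definition sixteen_area_squared :: "real^3 \<Rightarrow> real" where
  "sixteen_area_squared T =
     2 * T$1 * T$2 + 2 * T$2 * T$3 + 2 * T$3 * T$1 - (T$1)^2 - (T$2)^2 - (T$3)^2"

lemma true_triangle_iff:
  "true_triangle T \<longleftrightarrow> 0 < T$1 \<and> 0 < T$2 \<and> 0 < T$3 \<and> 0 < sixteen_area_squared T"
  by (simp add: true_triangle_def sixteen_area_squared_def Let_def)

lemma sixteen_area_squared_scaleR:
  "sixteen_area_squared (r *\<^sub>R T) = r^2 * sixteen_area_squared T"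
  by (simp add: sixteen_area_squared_def algebra_simps power2_eq_square)

lemma sixteen_area_squared_le:
  "sixteen_area_squared T \<le> 4 * (T$2 * T$3)"
  "sixteen_area_squared T \<le> 4 * (T$3 * T$1)"
  "sixteen_area_squared T \<le> 4 * (T$1 * T$2)"
  using zero_le_power2[of "T$2 + T$3 - T$1"] zero_le_power2[of "T$3 + T$1 - T$2"]
    zero_le_power2[of "T$1 + T$2 - T$3"]
  by (simp_all add: sixteen_area_squared_def power2_eq_square algebra_simps)

text \<open>
  An Euler configuration lies on a line. In the limit shape of a double collision one side vanishes and the two
  others are equal.
\<close>

lemma end_points_flat:
  assumes "T \<in> end_points m"
  shows "sixteen_area_squared T = 0"
proof -
  have euler: "sixteen_area_squared T = 0" if eul: "euler_config m T" for T
  proof -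
    obtain x :: "3 \<Rightarrow> real" where "has_sides x T"
      using eul unfolding euler_config_def by blast
    then have T: "T$1 = (x 2 - x 3)^2" "T$2 = (x 1 - x 3)^2" "T$3 = (x 1 - x 2)^2"
      by (auto simp: has_sides_def dist_real_def)
    show ?thesis
      unfolding sixteen_area_squared_def T by algebra
  qed
  have "sixteen_area_squared T = 0" if "T \<in> double_collisions" for T
    using that by (auto simp: double_collisions_def sixteen_area_squared_def vector_3)
  with euler assms show ?thesis
    by (auto simp: end_points_def unit_size_def sixteen_area_squared_scaleR)
qed

section \<open>Balanced triangles in coordinates along the axes of inertia\<close>

text \<open>
  Here \<open>x i p\<close> is the coordinate of body \<open>i\<close> along the \<open>p\<close>-th axis of inertia. In these coordinates
  the equation \<open>- W \<xi>\<^sub>i = acceleration\<close> splits into one equation for each axis, which involves only the number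
  \<open>\<omega> p\<close>; the endomorphism \<open>W\<close> and the rotation of the axes no longer appear.
\<close>

locale balanced_coordinates =
  fixes m :: "3 \<Rightarrow> real" and x :: "3 \<Rightarrow> 2 \<Rightarrow> real" and T :: "real^3"
    and \<Theta> \<omega> :: "2 \<Rightarrow> real"
  assumes mass_pos: "0 < m i"
    and triangle: "true_triangle T"
    and freq_pos: "0 < \<omega> p"
    and sides: "T$1 = (x 2 1 - x 3 1)^2 + (x 2 2 - x 3 2)^2"
      "T$2 = (x 1 1 - x 3 1)^2 + (x 1 2 - x 3 2)^2"
      "T$3 = (x 1 1 - x 2 1)^2 + (x 1 2 - x 2 2)^2"
    and centre: "m 1 * x 1 p + m 2 * x 2 p + m 3 * x 3 p = 0"
    and principal: "m 1 * x 1 1 * x 1 2 + m 2 * x 2 1 * x 2 2 + m 3 * x 3 1 * x 3 2 = 0"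
    and moment: "\<Theta> p = m 1 * (x 1 p)^2 + m 2 * (x 2 p)^2 + m 3 * (x 3 p)^2"
    and force:
      "- ((\<omega> p)^2 * x 1 p) =
         m 2 / sqrt (T$3) ^ 3 * (x 2 p - x 1 p) + m 3 / sqrt (T$2) ^ 3 * (x 3 p - x 1 p)"
      "- ((\<omega> p)^2 * x 2 p) =
         m 1 / sqrt (T$3) ^ 3 * (x 1 p - x 2 p) + m 3 / sqrt (T$1) ^ 3 * (x 3 p - x 2 p)"
      "- ((\<omega> p)^2 * x 3 p) =
         m 1 / sqrt (T$2) ^ 3 * (x 1 p - x 3 p) + m 2 / sqrt (T$1) ^ 3 * (x 2 p - x 3 p)"
begin

text \<open>
  The stiffness of the side opposite to body \<open>i\<close> is the product of the masses at its ends divided by the cube of its length: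
  if the attraction along that side is written as a linear spring force, it is the spring constant.
\<close>

definition stiffness :: "3 \<Rightarrow> real" where
  "stiffness i = m 1 * m 2 * m 3 / m i / sqrt (T$i) ^ 3"

lemma side_pos: "0 < T$1" "0 < T$2" "0 < T$3"
  using triangle by (auto simp: true_triangle_iff)

lemma area_pos: "0 < sixteen_area_squared T"
  using triangle by (auto simp: true_triangle_iff)

lemma stiffness_simps:
  "stiffness 1 = m 2 * m 3 / sqrt (T$1) ^ 3"
  "stiffness 2 = m 1 * m 3 / sqrt (T$2) ^ 3"
  "stiffness 3 = m 1 * m 2 / sqrt (T$3) ^ 3"
  using mass_pos[of 1] mass_pos[of 2] mass_pos[of 3] by (simp_all add: stiffness_def)

text \<open>
  The work of the forces under a displacement \<open>y\<close> along one axis can be summed over the bodies or over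
  the sides. Taking for \<open>y\<close> the coordinates along the same axis, along the other axis, or the velocities
  gives \<open>moment_freq\<close>, the orthogonality used in \<open>freq_product\<close>, and the derivative of the potential.
\<close>

lemma force_pairing:
  fixes y :: "3 \<Rightarrow> real"
  shows "(\<omega> p)^2 * (m 1 * x 1 p * y 1 + m 2 * x 2 p * y 2 + m 3 * x 3 p * y 3) =
     stiffness 1 * ((x 2 p - x 3 p) * (y 2 - y 3))
     + stiffness 2 * ((x 1 p - x 3 p) * (y 1 - y 3))
     + stiffness 3 * ((x 1 p - x 2 p) * (y 1 - y 2))"
proof -
  define A where "A = 1 / sqrt (T$1) ^ 3"
  define B where "B = 1 / sqrt (T$2) ^ 3"
  define C where "C = 1 / sqrt (T$3) ^ 3"
  have f: "(\<omega> p)^2 * x 1 p = - (m 2 * C * (x 2 p - x 1 p) + m 3 * B * (x 3 p - x 1 p))"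
    "(\<omega> p)^2 * x 2 p = - (m 1 * C * (x 1 p - x 2 p) + m 3 * A * (x 3 p - x 2 p))"
    "(\<omega> p)^2 * x 3 p = - (m 1 * B * (x 1 p - x 3 p) + m 2 * A * (x 2 p - x 3 p))"
    using force[of p] by (simp_all add: A_def B_def C_def)
  have "(\<omega> p)^2 * (m 1 * x 1 p * y 1 + m 2 * x 2 p * y 2 + m 3 * x 3 p * y 3)
      = m 1 * y 1 * ((\<omega> p)^2 * x 1 p) + m 2 * y 2 * ((\<omega> p)^2 * x 2 p) + m 3 * y 3 * ((\<omega> p)^2 * x 3 p)"
    by (simp add: algebra_simps)
  also have "\<dots> = (m 2 * m 3 * A) * ((x 2 p - x 3 p) * (y 2 - y 3))
     + (m 1 * m 3 * B) * ((x 1 p - x 3 p) * (y 1 - y 3))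
     + (m 1 * m 2 * C) * ((x 1 p - x 2 p) * (y 1 - y 2))"
    unfolding f by (simp add: algebra_simps)
  finally show ?thesis by (simp add: stiffness_simps A_def B_def C_def)
qed

lemma moment_freq:
  "\<Theta> p * (\<omega> p)^2 = stiffness 1 * (x 2 p - x 3 p)^2 + stiffness 2 * (x 1 p - x 3 p)^2
     + stiffness 3 * (x 1 p - x 2 p)^2"
  using force_pairing[of p "\<lambda>i. x i p"]
  by (simp add: moment power2_eq_square algebra_simps)

lemma moment_by_sides:
  "(m 1 + m 2 + m 3) * \<Theta> p =
     m 2 * m 3 * (x 2 p - x 3 p)^2 + m 1 * m 3 * (x 1 p - x 3 p)^2 + m 1 * m 2 * (x 1 p - x 2 p)^2"
proof -
  have "(m 1 + m 2 + m 3) * \<Theta> p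
    = m 2 * m 3 * (x 2 p - x 3 p)^2 + m 1 * m 3 * (x 1 p - x 3 p)^2 + m 1 * m 2 * (x 1 p - x 2 p)^2
      + (m 1 * x 1 p + m 2 * x 2 p + m 3 * x 3 p)^2"
    unfolding moment by algebra
  then show ?thesis by (simp add: centre)
qed

definition double_area :: real where
  "double_area = (x 2 1 - x 1 1) * (x 3 2 - x 1 2) - (x 3 1 - x 1 1) * (x 2 2 - x 1 2)"

lemma double_area_squared: "4 * double_area^2 = sixteen_area_squared T"
proof -
  have heron: "4 * (b1 * a2 - b2 * a1)^2 =
      2 * A * B + 2 * B * C + 2 * C * A - A^2 - B^2 - C^2"
    if "A = a1^2 + a2^2" "B = b1^2 + b2^2" "C = (b1 - a1)^2 + (b2 - a2)^2"
    for a1 a2 b1 b2 A B C :: real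
    unfolding that by algebra
  have "double_area = (x 1 1 - x 3 1) * (x 2 2 - x 3 2) - (x 1 2 - x 3 2) * (x 2 1 - x 3 1)"
    by (simp add: double_area_def algebra_simps)
  then show ?thesis
    unfolding sixteen_area_squared_def by (simp only:) (rule heron; simp add: sides)
qed

text \<open>
  As the inertia matrix is diagonal in these axes, \<open>\<Theta> 1 * \<Theta> 2\<close> is its determinant. By the
  Cauchy--Binet formula it is the mass-weighted sum of the squares of the areas that pairs of bodies span with the centre of mass; these three
  areas are proportional to the opposite masses.
\<close>

lemma moment_product:
  "(m 1 + m 2 + m 3) * (\<Theta> 1 * \<Theta> 2) = m 1 * m 2 * m 3 * double_area^2"
proof -
  define c where "c = (\<lambda>i j. x i 1 * x j 2 - x j 1 * x i 2)"
  have eqs: "m 2 * c 1 2 = m 3 * c 3 1" "m 3 * c 2 3 = m 1 * c 1 2" "m 1 * c 3 1 = m 2 * c 2 3"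
    using centre[of 1] centre[of 2] unfolding c_def by algebra+
  \<comment> \<open>The bodies \<open>i\<close> and \<open>j\<close> span, with the centre of mass, an area proportional to the third mass.\<close>
  define t where "t = c 1 2 / m 3"
  have c: "c 1 2 = m 3 * t" "c 2 3 = m 1 * t" "c 3 1 = m 2 * t"
    using eqs mass_pos[of 1] mass_pos[of 2] mass_pos[of 3] by (auto simp: t_def field_simps)
  have "double_area = c 1 2 + c 2 3 + c 3 1" by (simp add: double_area_def c_def algebra_simps)
  then have cr: "double_area = (m 1 + m 2 + m 3) * t" by (simp add: c algebra_simps)
  have "\<Theta> 1 * \<Theta> 2 = m 1 * m 2 * (c 1 2)^2 + m 2 * m 3 * (c 2 3)^2 + m 1 * m 3 * (c 3 1)^2
     + (m 1 * x 1 1 * x 1 2 + m 2 * x 2 1 * x 2 2 + m 3 * x 3 1 * x 3 2)^2"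
    unfolding moment c_def by algebra
  also have "\<dots> = m 1 * m 2 * m 3 * (m 1 + m 2 + m 3) * t^2"
    unfolding principal c by (simp add: power2_eq_square algebra_simps)
  finally show ?thesis unfolding cr by (simp add: power2_eq_square algebra_simps)
qed

lemma moment_pos: "0 < \<Theta> p"
proof -
  have nn: "0 \<le> \<Theta> p" for p
    unfolding moment using mass_pos by (simp add: less_imp_le)
  have "0 < double_area^2" using area_pos double_area_squared by linarith
  then have "0 < (m 1 + m 2 + m 3) * (\<Theta> 1 * \<Theta> 2)"
    unfolding moment_product using mass_pos by simp
  then have "\<Theta> 1 \<noteq> 0" "\<Theta> 2 \<noteq> 0" by auto
  with nn[of 1] nn[of 2] have "0 < \<Theta> 1" "0 < \<Theta> 2" by auto
  then show ?thesis using exhaust_2[of p] by auto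
qed

text \<open>
  The numbers \<open>\<Theta> p * (\<omega> p)^2\<close> are the diagonal entries of the sum, over the sides, of the stiffness times the rank-one
  matrix of the side vector. Its off-diagonal entry is \<open>0\<close>, so their product is its determinant, and any two sides span the
  same parallelogram, up to sign.
\<close>

lemma freq_product:
  "\<Theta> 1 * (\<omega> 1)^2 * (\<Theta> 2 * (\<omega> 2)^2) =
     double_area^2 * (stiffness 2 * stiffness 3 + stiffness 3 * stiffness 1 + stiffness 1 * stiffness 2)"
proof -
  have off: "stiffness 1 * ((x 2 1 - x 3 1) * (x 2 2 - x 3 2))
     + stiffness 2 * ((x 1 1 - x 3 1) * (x 1 2 - x 3 2))
     + stiffness 3 * ((x 1 1 - x 2 1) * (x 1 2 - x 2 2)) = 0"
    using force_pairing[of 1 "\<lambda>i. x i 2"] principal by simp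
  have binet: "(A * a1^2 + B * b1^2 + C * c1^2) * (A * a2^2 + B * b2^2 + C * c2^2) =
      (b1 * a2 - b2 * a1)^2 * (B * C + C * A + A * B) + (A * (a1 * a2) + B * (b1 * b2) + C * (c1 * c2))^2"
    if "c1 = b1 - a1" "c2 = b2 - a2" for a1 a2 b1 b2 c1 c2 A B C :: real
    unfolding that by (simp add: power2_eq_square algebra_simps)
  have cr: "double_area = (x 1 1 - x 3 1) * (x 2 2 - x 3 2) - (x 1 2 - x 3 2) * (x 2 1 - x 3 1)"
    by (simp add: double_area_def algebra_simps)
  show ?thesis
    unfolding moment_freq cr by (subst binet) (simp_all add: off)
qed

text \<open>
  The kinetic energy of the relative equilibrium is half the potential, so \<open>energy\<close> is minus half of the left-hand side.
\<close>

lemma virial: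
  "\<Theta> 1 * (\<omega> 1)^2 + \<Theta> 2 * (\<omega> 2)^2 =
     m 2 * m 3 / sqrt (T$1) + m 1 * m 3 / sqrt (T$2) + m 1 * m 2 / sqrt (T$3)"
proof -
  have "\<Theta> 1 * (\<omega> 1)^2 + \<Theta> 2 * (\<omega> 2)^2 = stiffness 1 * T$1 + stiffness 2 * T$2 + stiffness 3 * T$3"
    unfolding moment_freq sides by (simp add: algebra_simps)
  also have "\<dots> = stiffness 1 * (sqrt (T$1))^2 + stiffness 2 * (sqrt (T$2))^2 + stiffness 3 * (sqrt (T$3))^2"
    using side_pos by simp
  also have "\<dots> = m 2 * m 3 / sqrt (T$1) + m 1 * m 3 / sqrt (T$2) + m 1 * m 2 / sqrt (T$3)"
    unfolding stiffness_simps using side_pos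
    by (simp add: power3_eq_cube power2_eq_square)
  finally show ?thesis .
qed

lemma k_pos: "0 < k_value \<Theta> \<omega>"
  unfolding k_value_def Let_def
  by (intro divide_pos_pos mult_pos_pos zero_less_power add_pos_pos moment_pos freq_pos)

text \<open>
  Each term of \<open>moment_product\<close> times \<open>freq_product\<close> is a fourth power of the area divided by the cubes of
  two sides. The area is at most half the product of these two sides, so three of the four
  factors compensate the denominator and one remains.
\<close>

lemma momentum_product_le:
  "(\<Theta> 1 * \<omega> 1 * (\<Theta> 2 * \<omega> 2))^2 \<le> (m 1 * m 2 * m 3)^2 / 2 * sqrt (sixteen_area_squared T)"
proof -
  define D where "D = sqrt (sixteen_area_squared T)"
  define M where "M = m 1 + m 2 + m 3"
  define P where "P = m 1 * m 2 * m 3"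
  have M: "0 < M" using mass_pos by (simp add: M_def add_pos_pos)
  have P: "0 < P" using mass_pos by (simp add: P_def)
  have D: "0 < D" using area_pos by (simp add: D_def)
  have D2: "double_area^2 = D^2 / 4" using double_area_squared area_pos by (simp add: D_def)
  have le: "D^4 / (sqrt u * sqrt v) ^ 3 \<le> 8 * D"
    if "sixteen_area_squared T \<le> 4 * (u * v)" "0 < u" "0 < v" for u v
  proof -
    have "D \<le> sqrt (4 * (u * v))" unfolding D_def using that(1) by (rule real_sqrt_le_mono)
    also have "\<dots> = 2 * (sqrt u * sqrt v)" by (simp add: real_sqrt_mult)
    finally have "D^3 \<le> (2 * (sqrt u * sqrt v))^3" using D by (intro power_mono) auto
    then have "D * D^3 \<le> D * (8 * (sqrt u * sqrt v)^3)"
      using D by (intro mult_left_mono) (auto simp: power_mult_distrib)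
    then show ?thesis using that by (simp add: field_simps power4_eq_xxxx power3_eq_cube)
  qed
  have st: "stiffness 2 * stiffness 3 = P * m 1 / (sqrt (T$2) * sqrt (T$3)) ^ 3"
    "stiffness 3 * stiffness 1 = P * m 2 / (sqrt (T$3) * sqrt (T$1)) ^ 3"
    "stiffness 1 * stiffness 2 = P * m 3 / (sqrt (T$1) * sqrt (T$2)) ^ 3"
    by (simp_all add: stiffness_simps P_def power_mult_distrib)
  have "M * (\<Theta> 1 * \<omega> 1 * (\<Theta> 2 * \<omega> 2))^2
      = (M * (\<Theta> 1 * \<Theta> 2)) * (\<Theta> 1 * (\<omega> 1)^2 * (\<Theta> 2 * (\<omega> 2)^2))"
    by (simp add: power2_eq_square algebra_simps)
  also have "\<dots> = P^2 / 16 * (m 1 * (D^4 / (sqrt (T$2) * sqrt (T$3)) ^ 3)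
      + m 2 * (D^4 / (sqrt (T$3) * sqrt (T$1)) ^ 3) + m 3 * (D^4 / (sqrt (T$1) * sqrt (T$2)) ^ 3))"
    unfolding freq_product M_def moment_product st D2 P_def[symmetric]
    by (simp add: algebra_simps power2_eq_square power4_eq_xxxx)
  also have "\<dots> \<le> P^2 / 16 * (m 1 * (8 * D) + m 2 * (8 * D) + m 3 * (8 * D))"
    by (intro mult_left_mono add_mono le sixteen_area_squared_le side_pos less_imp_le[OF mass_pos])
      simp
  also have "\<dots> = M * (P^2 / 2 * D)" by (simp add: M_def algebra_simps)
  finally show ?thesis using M by (simp add: P_def D_def)
qed

text \<open>
  By \<open>moment_freq\<close> and \<open>moment_by_sides\<close>, \<open>(\<omega> p)^2\<close> is a weighted mean of the three numbers
  \<open>(m 1 + m 2 + m 3) / d^3\<close>, where \<open>d\<close> runs over the sides. Hence both frequencies are bounded below in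
  terms of the size, and so is \<open>\<Theta> 1 + \<Theta> 2\<close>.
\<close>

lemma momentum_sum_ge:
  assumes "0 < q" "q \<le> m 2 * m 3" "q \<le> m 1 * m 3" "q \<le> m 1 * m 2"
  shows "q^2 / (m 1 + m 2 + m 3) * sqrt (T$1 + T$2 + T$3) \<le> (\<Theta> 1 * \<omega> 1 + \<Theta> 2 * \<omega> 2)^2"
proof -
  define M where "M = m 1 + m 2 + m 3"
  define \<sigma> where "\<sigma> = T$1 + T$2 + T$3"
  \<comment> \<open>Every side is at most \<open>r\<close>, which makes \<open>l\<close> a lower bound of both frequencies.\<close>
  define r where "r = sqrt \<sigma>"
  define l where "l = sqrt (M / r^3)"
  have M: "0 < M" using mass_pos by (simp add: M_def add_pos_pos)
  have \<sigma>: "0 < \<sigma>" using side_pos by (simp add: \<sigma>_def)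
  have r: "0 < r" "r^2 = \<sigma>" using \<sigma> by (simp_all add: r_def)
  have l: "0 < l" "l^2 = M / r^3" using M r by (simp_all add: l_def)
  have cube: "n / r^3 \<le> n / sqrt (T$i)^3" if "0 < T$i" "T$i \<le> \<sigma>" "0 \<le> n" for n i
    by (intro divide_left_mono power_mono zero_less_power mult_pos_pos)
      (use that r in \<open>auto simp: r_def\<close>)
  have st: "m 2 * m 3 / r^3 \<le> stiffness 1" "m 1 * m 3 / r^3 \<le> stiffness 2" "m 1 * m 2 / r^3 \<le> stiffness 3"
    unfolding stiffness_simps using side_pos mass_pos
    by (intro cube; simp add: \<sigma>_def less_imp_le)+
  have freq: "l \<le> \<omega> p" for p
  proof -
    have "\<Theta> p * l^2 = (M * \<Theta> p) / r^3" by (simp add: l)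
    also have "\<dots> = m 2 * m 3 / r^3 * (x 2 p - x 3 p)^2 + m 1 * m 3 / r^3 * (x 1 p - x 3 p)^2
        + m 1 * m 2 / r^3 * (x 1 p - x 2 p)^2"
      unfolding M_def moment_by_sides by (simp add: add_divide_distrib)
    also have "\<dots> \<le> \<Theta> p * (\<omega> p)^2"
      unfolding moment_freq by (intro add_mono mult_right_mono st) auto
    finally have "l^2 \<le> (\<omega> p)^2" using moment_pos[of p] by simp
    then show ?thesis by (rule power2_le_imp_le[OF _ less_imp_le[OF freq_pos]])
  qed
  have "q * \<sigma> \<le> m 2 * m 3 * T$1 + m 1 * m 3 * T$2 + m 1 * m 2 * T$3"
    unfolding \<sigma>_def distrib_left
    by (intro add_mono mult_right_mono assms less_imp_le[OF side_pos(1)]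
        less_imp_le[OF side_pos(2)] less_imp_le[OF side_pos(3)])
  also have "\<dots> = M * \<Theta> 1 + M * \<Theta> 2"
    unfolding M_def moment_by_sides sides by (simp add: algebra_simps)
  finally have tr: "q * \<sigma> / M \<le> \<Theta> 1 + \<Theta> 2" using M by (simp add: field_simps)
  have "l * (q * \<sigma> / M) \<le> l * (\<Theta> 1 + \<Theta> 2)" by (rule mult_left_mono[OF tr less_imp_le[OF l(1)]])
  also have "\<dots> \<le> \<Theta> 1 * \<omega> 1 + \<Theta> 2 * \<omega> 2"
    using mult_left_mono[OF freq[of 1] less_imp_le[OF moment_pos[of 1]]]
      mult_left_mono[OF freq[of 2] less_imp_le[OF moment_pos[of 2]]] by (simp add: algebra_simps)
  finally have "(l * (q * \<sigma> / M))^2 \<le> (\<Theta> 1 * \<omega> 1 + \<Theta> 2 * \<omega> 2)^2"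
    using l M \<sigma> assms(1) by (intro power_mono) auto
  moreover have "(l * (q * \<sigma> / M))^2 = q^2 / M * r"
    using M r(1) by (simp add: power_mult_distrib power_divide l r(2)[symmetric])
      (simp add: field_simps power2_eq_square power3_eq_cube power4_eq_xxxx)
  ultimately show ?thesis by (simp add: M_def r_def \<sigma>_def)
qed

end

text \<open>
  The upper bound of \<open>(\<mu>\<^sub>1 \<mu>\<^sub>2)\<^sup>2\<close> and the square of the lower bound of \<open>(\<mu>\<^sub>1 + \<mu>\<^sub>2)\<^sup>2\<close> scale alike, so their
  quotient can be read on the triangle of unit size.
\<close>

lemma k_value_bound:
  fixes m :: "3 \<Rightarrow> real"
  assumes "\<And>i. 0 < m i"
  obtains C where "\<And>x T \<Theta> \<omega>. balanced_coordinates m x T \<Theta> \<omega> \<Longrightarrow>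
    (k_value \<Theta> \<omega>)^2 \<le> C * sqrt (sixteen_area_squared (unit_size T))"
proof -
  define q where "q = min (m 2 * m 3) (min (m 1 * m 3) (m 1 * m 2))"
  have q: "0 < q" "q \<le> m 2 * m 3" "q \<le> m 1 * m 3" "q \<le> m 1 * m 2"
    using assms by (auto simp: q_def)
  define Q where "Q = q^2 / (m 1 + m 2 + m 3)"
  have Q: "0 < Q" using q assms by (simp add: Q_def add_pos_pos)
  define P where "P = (m 1 * m 2 * m 3)^2 / 2"
  show thesis
  proof (rule that[of "P / Q^2"])
    fix x T \<Theta> \<omega> assume "balanced_coordinates m x T \<Theta> \<omega>"
    then interpret balanced_coordinates m x T \<Theta> \<omega> .
    define \<sigma> where "\<sigma> = T$1 + T$2 + T$3"
    have \<sigma>: "0 < \<sigma>" using side_pos by (simp add: \<sigma>_def)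
    have "Q * sqrt \<sigma> \<le> (\<Theta> 1 * \<omega> 1 + \<Theta> 2 * \<omega> 2)^2"
      using momentum_sum_ge[OF q] by (simp add: Q_def \<sigma>_def)
    then have "(Q * sqrt \<sigma>)^2 \<le> ((\<Theta> 1 * \<omega> 1 + \<Theta> 2 * \<omega> 2)^2)^2"
      using Q \<sigma> by (intro power_mono mult_nonneg_nonneg) auto
    then have den: "Q^2 * \<sigma> \<le> ((\<Theta> 1 * \<omega> 1 + \<Theta> 2 * \<omega> 2)^2)^2"
      using \<sigma> by (simp add: power_mult_distrib)
    have "(k_value \<Theta> \<omega>)^2
        = (\<Theta> 1 * \<omega> 1 * (\<Theta> 2 * \<omega> 2))^2 / ((\<Theta> 1 * \<omega> 1 + \<Theta> 2 * \<omega> 2)^2)^2"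
      by (simp add: k_value_def Let_def power_divide)
    also have "\<dots> \<le> (P * sqrt (sixteen_area_squared T)) / (Q^2 * \<sigma>)"
      using momentum_product_le den Q \<sigma> area_pos by (intro frac_le) (auto simp: P_def)
    also have "\<dots> = P / Q^2 * (sqrt (sixteen_area_squared T) / \<sigma>)" by simp
    also have "sqrt (sixteen_area_squared T) / \<sigma> = sqrt (sixteen_area_squared (unit_size T))"
      using \<sigma> unfolding unit_size_def sixteen_area_squared_scaleR \<sigma>_def[symmetric]
      by (simp add: real_sqrt_mult real_sqrt_divide power_divide)
    finally show "(k_value \<Theta> \<omega>)^2 \<le> P / Q^2 * sqrt (sixteen_area_squared (unit_size T))" .
  qed
qed

section \<open>Relative equilibria in their axes of inertia\<close>

lemma orthonormal_frame_expansion: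
  fixes e :: "2 \<Rightarrow> real^2"
  assumes "\<And>p q. e p \<bullet> e q = (if p = q then 1 else 0)"
  shows "v = (v \<bullet> e 1) *\<^sub>R e 1 + (v \<bullet> e 2) *\<^sub>R e 2"
proof -
  have dual: "a * (v * a + w * b) + c * (v * c + w * d) = v \<and> b * (v * a + w * b) + d * (v * c + w * d) = w"
    if "a * a + b * b = 1" "c * c + d * d = 1" "a * c + b * d = 0" for a b c d v w :: real
    using that by algebra
  have "e 1 $ 1 * e 1 $ 1 + e 1 $ 2 * e 1 $ 2 = 1" "e 2 $ 1 * e 2 $ 1 + e 2 $ 2 * e 2 $ 2 = 1"
    "e 1 $ 1 * e 2 $ 1 + e 1 $ 2 * e 2 $ 2 = 0"
    using assms[of 1 1] assms[of 2 2] assms[of 1 2] by (simp_all add: inner_vec_def sum_2)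
  from dual[OF this, of "v $ 1" "v $ 2"] show ?thesis
    by (simp add: vec_eq_iff forall_2 inner_vec_def sum_2 mult.commute)
qed

lemma orthonormal_frame_dist:
  fixes e :: "2 \<Rightarrow> real^2"
  assumes "\<And>p q. e p \<bullet> e q = (if p = q then 1 else 0)"
  shows "(dist u v)^2 = (u \<bullet> e 1 - v \<bullet> e 1)^2 + (u \<bullet> e 2 - v \<bullet> e 2)^2"
proof -
  define w where "w = u - v"
  have "w \<bullet> w = w \<bullet> ((w \<bullet> e 1) *\<^sub>R e 1 + (w \<bullet> e 2) *\<^sub>R e 2)"
    using orthonormal_frame_expansion[OF assms, of w] by simp
  also have "\<dots> = (w \<bullet> e 1)^2 + (w \<bullet> e 2)^2"
    by (simp add: inner_add_right power2_eq_square)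
  finally show ?thesis
    by (simp add: w_def dist_norm power2_norm_eq_inner inner_diff_left)
qed

lemma inertia_mult_inner:
  "(inertia m \<xi> *v v) \<bullet> w = (\<Sum>i\<in>UNIV. m i * (\<xi> i \<bullet> v) * (\<xi> i \<bullet> w))"
proof -
  have "inertia m \<xi> *v v = (\<Sum>i\<in>UNIV. (m i * (\<xi> i \<bullet> v)) *\<^sub>R \<xi> i)"
  proof (rule vec_eq_iff[THEN iffD2], intro allI)
    fix p
    have "(inertia m \<xi> *v v) $ p = (\<Sum>q\<in>UNIV. \<Sum>i\<in>UNIV. m i * \<xi> i $ p * \<xi> i $ q * v $ q)"
      by (simp add: inertia_def matrix_vector_mult_def sum_distrib_right)
    also have "\<dots> = (\<Sum>i\<in>UNIV. \<Sum>q\<in>UNIV. m i * \<xi> i $ p * \<xi> i $ q * v $ q)"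
      by (rule sum.swap)
    also have "\<dots> = (\<Sum>i\<in>UNIV. (m i * (\<xi> i \<bullet> v)) *\<^sub>R \<xi> i) $ p"
      by (simp add: inner_vec_def sum_distrib_left sum_distrib_right mult_ac)
    finally show "(inertia m \<xi> *v v) $ p = (\<Sum>i\<in>UNIV. (m i * (\<xi> i \<bullet> v)) *\<^sub>R \<xi> i) $ p" .
  qed
  then show ?thesis by (simp add: inner_sum_left)
qed

lemma balanced_coordinates_of_equilibrium:
  assumes mass: "\<And>i. 0 < m i" and tri: "true_triangle T"
    and eq: "equilibrium_data m T \<xi> e \<Theta> \<omega>"
  shows "balanced_coordinates m (\<lambda>i p. \<xi> i \<bullet> e p) T \<Theta> \<omega>"
proof -
  have sides: "(dist (\<xi> 2) (\<xi> 3))^2 = T$1" "(dist (\<xi> 1) (\<xi> 3))^2 = T$2" "(dist (\<xi> 1) (\<xi> 2))^2 = T$3"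
    and centre: "m 1 *\<^sub>R \<xi> 1 + m 2 *\<^sub>R \<xi> 2 + m 3 *\<^sub>R \<xi> 3 = 0"
    and ortho: "\<And>p q. e p \<bullet> e q = (if p = q then 1 else 0)"
    and inertia: "\<And>p. inertia m \<xi> *v e p = \<Theta> p *\<^sub>R e p"
    using eq by (auto simp: equilibrium_data_def has_sides_def centred_def sum_3)
  obtain W :: "real^2^2" where W: "\<And>i. - (W *v \<xi> i) = acceleration m \<xi> i"
    and \<omega>: "\<And>p. 0 < \<omega> p" "\<And>p. W *v e p = (\<omega> p)^2 *\<^sub>R e p"
    using eq unfolding equilibrium_data_def by blast
  have W_inner: "(W *v v) \<bullet> e p = (\<omega> p)^2 * (v \<bullet> e p)" for v p
  proof -
    have "W *v v = W *v ((v \<bullet> e 1) *\<^sub>R e 1 + (v \<bullet> e 2) *\<^sub>R e 2)"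
      using orthonormal_frame_expansion[OF ortho, of v] by simp
    also have "\<dots> = (v \<bullet> e 1) *\<^sub>R (\<omega> 1)^2 *\<^sub>R e 1 + (v \<bullet> e 2) *\<^sub>R (\<omega> 2)^2 *\<^sub>R e 2"
      by (simp only: matrix_vector_right_distrib matrix_vector_mult_scaleR \<omega>)
    finally show ?thesis
      using exhaust_2[of p] by (auto simp: inner_add_left ortho)
  qed
  have dist: "norm (\<xi> 3 - \<xi> 2) = sqrt (T$1)" "norm (\<xi> 2 - \<xi> 3) = sqrt (T$1)"
    "norm (\<xi> 3 - \<xi> 1) = sqrt (T$2)" "norm (\<xi> 1 - \<xi> 3) = sqrt (T$2)"
    "norm (\<xi> 2 - \<xi> 1) = sqrt (T$3)" "norm (\<xi> 1 - \<xi> 2) = sqrt (T$3)"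
    unfolding sides[symmetric] by (simp_all add: dist_norm norm_minus_commute)
  have others: "UNIV - {1::3} = {2, 3}" "UNIV - {2::3} = {1, 3}" "UNIV - {3::3} = {1, 2}"
    using exhaust_3 by auto
  have acc: "acceleration m \<xi> i \<bullet> e p = - ((\<omega> p)^2 * (\<xi> i \<bullet> e p))" for i p
    unfolding W[symmetric] by (simp add: W_inner)
  show ?thesis
  proof
    show "m 1 * (\<xi> 1 \<bullet> e p) + m 2 * (\<xi> 2 \<bullet> e p) + m 3 * (\<xi> 3 \<bullet> e p) = 0" for p
      using arg_cong[OF centre, of "\<lambda>v. v \<bullet> e p"] by (simp add: inner_add_left)
    show "m 1 * (\<xi> 1 \<bullet> e 1) * (\<xi> 1 \<bullet> e 2) + m 2 * (\<xi> 2 \<bullet> e 1) * (\<xi> 2 \<bullet> e 2)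
        + m 3 * (\<xi> 3 \<bullet> e 1) * (\<xi> 3 \<bullet> e 2) = 0"
      using inertia_mult_inner[of m \<xi> "e 1" "e 2"] by (simp add: inertia ortho sum_3)
    show "\<Theta> p = m 1 * (\<xi> 1 \<bullet> e p)^2 + m 2 * (\<xi> 2 \<bullet> e p)^2 + m 3 * (\<xi> 3 \<bullet> e p)^2" for p
      using inertia_mult_inner[of m \<xi> "e p" "e p"]
      by (simp add: inertia ortho sum_3 power2_eq_square mult.assoc)
    show "- ((\<omega> p)^2 * (\<xi> 1 \<bullet> e p)) = m 2 / sqrt (T$3) ^ 3 * (\<xi> 2 \<bullet> e p - \<xi> 1 \<bullet> e p)
        + m 3 / sqrt (T$2) ^ 3 * (\<xi> 3 \<bullet> e p - \<xi> 1 \<bullet> e p)" for p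
      unfolding acc[symmetric] by (simp add: acceleration_def others dist inner_add_left inner_diff_left)
    show "- ((\<omega> p)^2 * (\<xi> 2 \<bullet> e p)) = m 1 / sqrt (T$3) ^ 3 * (\<xi> 1 \<bullet> e p - \<xi> 2 \<bullet> e p)
        + m 3 / sqrt (T$1) ^ 3 * (\<xi> 3 \<bullet> e p - \<xi> 2 \<bullet> e p)" for p
      unfolding acc[symmetric] by (simp add: acceleration_def others dist inner_add_left inner_diff_left)
    show "- ((\<omega> p)^2 * (\<xi> 3 \<bullet> e p)) = m 1 / sqrt (T$2) ^ 3 * (\<xi> 1 \<bullet> e p - \<xi> 3 \<bullet> e p)
        + m 2 / sqrt (T$1) ^ 3 * (\<xi> 2 \<bullet> e p - \<xi> 3 \<bullet> e p)" for p
      unfolding acc[symmetric] by (simp add: acceleration_def others dist inner_add_left inner_diff_left)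
  qed (use mass tri \<omega> in \<open>simp_all add: sides[symmetric] orthonormal_frame_dist[OF ortho]\<close>)
qed

section \<open>The first variation of the energy\<close>

text \<open>
  This is \<open>dH = \<omega>\<^sub>1 d\<mu>\<^sub>1 + \<omega>\<^sub>2 d\<mu>\<^sub>2\<close>. The forces are \<open>- \<omega>\<^sub>p\<^sup>2 m\<^sub>i x\<^sub>i\<^sub>p\<close>, so the potential varies by
  \<open>dU = - (\<omega>\<^sub>1\<^sup>2 d\<Theta>\<^sub>1 + \<omega>\<^sub>2\<^sup>2 d\<Theta>\<^sub>2) / 2\<close>; add the variation of the kinetic energy. The coordinates are assumed
  differentiable, while the differentiability of the moments and the frequencies is a consequence: the frequencies
  are square roots of positive differentiable functions, by \<open>moment_freq\<close>.
\<close>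

lemma first_variation:
  fixes x :: "real \<Rightarrow> 3 \<Rightarrow> 2 \<Rightarrow> real"
  assumes I: "open I" "s \<in> I"
    and bal: "\<And>t. t \<in> I \<Longrightarrow> balanced_coordinates m (x t) (T t) (\<Theta> t) (\<omega> t)"
    and diff: "\<And>i p. (\<lambda>t. x t i p) differentiable (at s)"
  obtains \<mu>' where
    "\<And>p. ((\<lambda>t. \<Theta> t p * \<omega> t p) has_real_derivative \<mu>' p) (at s)"
    "((\<lambda>t. energy m (T t) (\<Theta> t) (\<omega> t)) has_real_derivative \<omega> s 1 * \<mu>' 1 + \<omega> s 2 * \<mu>' 2) (at s)"
proof -
  interpret balanced_coordinates m "x s" "T s" "\<Theta> s" "\<omega> s" using bal[OF I(2)] .
  note transform = has_field_derivative_transform_within_open[OF _ I]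
  have "\<exists>D. ((\<lambda>t. x t i p) has_real_derivative D) (at s)" for i p
    using diff[of i p] by (simp add: real_differentiable_def)
  then obtain x' where x': "\<And>i p. ((\<lambda>t. x t i p) has_real_derivative x' i p) (at s)"
    by metis
  have dist_deriv: "((\<lambda>t. (x t i 1 - x t j 1)^2 + (x t i 2 - x t j 2)^2) has_real_derivative
      2 * ((x s i 1 - x s j 1) * (x' i 1 - x' j 1) + (x s i 2 - x s j 2) * (x' i 2 - x' j 2))) (at s)"
    for i j
    by (rule derivative_eq_intros x' refl)+ (simp add: algebra_simps)
  define T' where "T' = (\<lambda>i j. 2 * ((x s i 1 - x s j 1) * (x' i 1 - x' j 1)
      + (x s i 2 - x s j 2) * (x' i 2 - x' j 2)))"
  have T': "((\<lambda>t. T t $ 1) has_real_derivative T' 2 3) (at s)"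
    "((\<lambda>t. T t $ 2) has_real_derivative T' 1 3) (at s)"
    "((\<lambda>t. T t $ 3) has_real_derivative T' 1 2) (at s)"
    unfolding T'_def
    by (rule transform[OF dist_deriv], simp add: balanced_coordinates.sides[OF bal])+
  define \<Theta>' where "\<Theta>' = (\<lambda>p. 2 * (m 1 * x s 1 p * x' 1 p + m 2 * x s 2 p * x' 2 p + m 3 * x s 3 p * x' 3 p))"
  have "((\<lambda>t. m 1 * (x t 1 p)^2 + m 2 * (x t 2 p)^2 + m 3 * (x t 3 p)^2) has_real_derivative \<Theta>' p) (at s)" for p
    unfolding \<Theta>'_def by (rule derivative_eq_intros x' refl)+ (simp add: algebra_simps)
  then have \<Theta>': "((\<lambda>t. \<Theta> t p) has_real_derivative \<Theta>' p) (at s)" for p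
    by (rule transform) (simp add: balanced_coordinates.moment[OF bal])
  have pot: "((\<lambda>t. n / sqrt (T t $ i)) has_real_derivative - n / sqrt (T s $ i)^3 * (D / 2)) (at s)"
    if "((\<lambda>t. T t $ i) has_real_derivative D) (at s)" "0 < T s $ i" for n D i
    using that by (auto intro!: derivative_eq_intros simp: field_simps power3_eq_cube)
  define U where "U = (\<lambda>t. m 2 * m 3 / sqrt (T t $ 1) + m 1 * m 3 / sqrt (T t $ 2) + m 1 * m 2 / sqrt (T t $ 3))"
  have "(U has_real_derivative
      - (stiffness 1 * (T' 2 3 / 2) + stiffness 2 * (T' 1 3 / 2) + stiffness 3 * (T' 1 2 / 2))) (at s)"
    unfolding U_def
    by (rule DERIV_cong[OF DERIV_add[OF DERIV_add[OF pot[OF T'(1) side_pos(1)] pot[OF T'(2) side_pos(2)]]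
          pot[OF T'(3) side_pos(3)]]]) (simp add: stiffness_simps)
  also have "stiffness 1 * (T' 2 3 / 2) + stiffness 2 * (T' 1 3 / 2) + stiffness 3 * (T' 1 2 / 2)
      = (\<omega> s 1)^2 * (\<Theta>' 1 / 2) + (\<omega> s 2)^2 * (\<Theta>' 2 / 2)"
  proof -
    have half: "\<Theta>' p / 2 = m 1 * x s 1 p * x' 1 p + m 2 * x s 2 p * x' 2 p + m 3 * x s 3 p * x' 3 p" for p
      by (simp add: \<Theta>'_def)
    have "(\<omega> s p)^2 * (\<Theta>' p / 2) = stiffness 1 * ((x s 2 p - x s 3 p) * (x' 2 p - x' 3 p))
       + stiffness 2 * ((x s 1 p - x s 3 p) * (x' 1 p - x' 3 p))
       + stiffness 3 * ((x s 1 p - x s 2 p) * (x' 1 p - x' 2 p))" for p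
      unfolding half by (rule force_pairing)
    moreover have "T' i j / 2 = (x s i 1 - x s j 1) * (x' i 1 - x' j 1) + (x s i 2 - x s j 2) * (x' i 2 - x' j 2)"
      for i j by (simp add: T'_def)
    ultimately show ?thesis by (simp only: distrib_left)
  qed
  finally have U': "(U has_real_derivative - ((\<omega> s 1)^2 * (\<Theta>' 1 / 2) + (\<omega> s 2)^2 * (\<Theta>' 2 / 2))) (at s)" .
  have "\<exists>D. ((\<lambda>t. \<omega> t p) has_real_derivative D) (at s)" for p
  proof -
    define F where "F = (\<lambda>t. (m 2 * m 3 / sqrt (T t $ 1) ^ 3 * (x t 2 p - x t 3 p)^2
      + m 1 * m 3 / sqrt (T t $ 2) ^ 3 * (x t 1 p - x t 3 p)^2
      + m 1 * m 2 / sqrt (T t $ 3) ^ 3 * (x t 1 p - x t 2 p)^2) / \<Theta> t p)"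
    have F: "F t = (\<omega> t p)^2" if "t \<in> I" for t
    proof -
      interpret t: balanced_coordinates m "x t" "T t" "\<Theta> t" "\<omega> t" using bal[OF that] .
      show ?thesis
        using t.moment_freq[of p] t.moment_pos[of p] by (simp add: F_def t.stiffness_simps field_simps)
    qed
    have "\<exists>D. (F has_real_derivative D) (at s)"
    proof -
      have sq: "(\<lambda>t. sqrt (T t $ i)) differentiable (at s)"
        if "((\<lambda>t. T t $ i) has_real_derivative D) (at s)" "0 < T s $ i" for i D
        using DERIV_chain2[OF DERIV_real_sqrt[OF that(2)] that(1)]
        unfolding real_differentiable_def by blast
      have \<Theta>: "(\<lambda>t. \<Theta> t p) differentiable (at s)"
        using \<Theta>' by (auto simp: real_differentiable_def)
      have nz: "sqrt (T s $ 1) ^ 3 \<noteq> 0" "sqrt (T s $ 2) ^ 3 \<noteq> 0" "sqrt (T s $ 3) ^ 3 \<noteq> 0" "\<Theta> s p \<noteq> 0"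
        using side_pos moment_pos[of p] by simp_all
      have "F differentiable (at s)"
        unfolding F_def
        by (intro differentiable_divide differentiable_add differentiable_mult differentiable_diff
            differentiable_power differentiable_const diff \<Theta> sq[OF T'(1) side_pos(1)]
            sq[OF T'(2) side_pos(2)] sq[OF T'(3) side_pos(3)] nz)
      then show ?thesis by (simp add: real_differentiable_def)
    qed
    then obtain D where "(F has_real_derivative D) (at s)" by blast
    moreover have "0 < F s" using F[OF I(2)] freq_pos[of p] by simp
    ultimately have "((\<lambda>t. sqrt (F t)) has_real_derivative D / (2 * sqrt (F s))) (at s)"
      by (auto intro!: derivative_eq_intros simp: field_simps)
    then have "((\<lambda>t. \<omega> t p) has_real_derivative D / (2 * sqrt (F s))) (at s)"
      by (rule transform) (use F balanced_coordinates.freq_pos[OF bal] in \<open>simp add: less_imp_le\<close>)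
    then show ?thesis by blast
  qed
  then obtain \<omega>' where \<omega>': "\<And>p. ((\<lambda>t. \<omega> t p) has_real_derivative \<omega>' p) (at s)" by metis
  show thesis
  proof (rule that)
    show "((\<lambda>t. \<Theta> t p * \<omega> t p) has_real_derivative \<Theta>' p * \<omega> s p + \<Theta> s p * \<omega>' p) (at s)" for p
      by (rule DERIV_cong[OF DERIV_mult[OF \<Theta>' \<omega>']]) (simp add: algebra_simps)
    have "((\<lambda>t. 1/2 * (\<Theta> t 1 * (\<omega> t 1)^2 + \<Theta> t 2 * (\<omega> t 2)^2) - U t) has_real_derivative
        \<omega> s 1 * (\<Theta>' 1 * \<omega> s 1 + \<Theta> s 1 * \<omega>' 1) + \<omega> s 2 * (\<Theta>' 2 * \<omega> s 2 + \<Theta> s 2 * \<omega>' 2)) (at s)"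
      by (rule derivative_eq_intros \<Theta>' \<omega>' U' refl)+ (simp add: algebra_simps power2_eq_square)
    then show "((\<lambda>t. energy m (T t) (\<Theta> t) (\<omega> t)) has_real_derivative
        \<omega> s 1 * (\<Theta>' 1 * \<omega> s 1 + \<Theta> s 1 * \<omega>' 1) + \<omega> s 2 * (\<Theta>' 2 * \<omega> s 2 + \<Theta> s 2 * \<omega>' 2)) (at s)"
      by (simp add: energy_def U_def)
  qed
qed

text \<open>
  With \<open>\<mu>\<^sub>1 + \<mu>\<^sub>2\<close> normalised to \<open>1\<close>, both \<open>dk = (\<mu>\<^sub>2 - \<mu>\<^sub>1) d\<mu>\<^sub>1\<close> and
  \<open>dH = (\<omega>\<^sub>1 - \<omega>\<^sub>2) d\<mu>\<^sub>1\<close> are multiples of \<open>d\<mu>\<^sub>1\<close>, and the first factor vanishes only if \<open>k = 1/4\<close>.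
  The proof is the same argument without normalisation.
\<close>

lemma cusp_at_stationary_k:
  fixes T :: "real \<Rightarrow> real^3" and \<Theta> \<omega> :: "real \<Rightarrow> 2 \<Rightarrow> real"
  assumes bal: "balanced_coordinates m x (T s) (\<Theta> s) (\<omega> s)"
    and \<mu>': "\<And>p. ((\<lambda>t. \<Theta> t p * \<omega> t p) has_real_derivative \<mu>' p) (at s)"
    and H': "((\<lambda>t. energy m (T t) (\<Theta> t) (\<omega> t)) has_real_derivative
      \<omega> s 1 * \<mu>' 1 + \<omega> s 2 * \<mu>' 2) (at s)"
    and k': "((\<lambda>t. k_value (\<Theta> t) (\<omega> t)) has_real_derivative 0) (at s)"
    and k: "k_value (\<Theta> s) (\<omega> s) \<noteq> 1/4"
  shows "cusp_at (\<lambda>t. h_value m (T t) (\<Theta> t) (\<omega> t)) (\<lambda>t. k_value (\<Theta> t) (\<omega> t)) s"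
proof -
  interpret balanced_coordinates m x "T s" "\<Theta> s" "\<omega> s" by (rule bal)
  define \<mu> where "\<mu> = (\<lambda>p. \<Theta> s p * \<omega> s p)"
  define H where "H = energy m (T s) (\<Theta> s) (\<omega> s)"
  have pos: "0 < \<mu> p" for p by (simp add: \<mu>_def moment_pos freq_pos)
  have sum_pos: "0 < \<mu> 1 + \<mu> 2" using pos by (simp add: add_pos_pos)
  have ne: "\<mu> 1 \<noteq> \<mu> 2"
  proof
    assume "\<mu> 1 = \<mu> 2"
    then have "k_value (\<Theta> s) (\<omega> s) = \<mu> 2 * \<mu> 2 / (\<mu> 2 + \<mu> 2)^2"
      by (simp add: k_value_def Let_def \<mu>_def)
    also have "\<dots> = 1/4" using pos[of 2] by (simp add: field_simps power2_eq_square)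
    finally show False using k by simp
  qed
  have num: "((\<lambda>t. \<Theta> t 1 * \<omega> t 1 * (\<Theta> t 2 * \<omega> t 2)) has_real_derivative
      \<mu>' 1 * \<mu> 2 + \<mu> 1 * \<mu>' 2) (at s)"
    by (rule DERIV_cong[OF DERIV_mult[OF \<mu>' \<mu>']]) (simp add: \<mu>_def)
  have den: "((\<lambda>t. (\<Theta> t 1 * \<omega> t 1 + \<Theta> t 2 * \<omega> t 2)^2) has_real_derivative
      2 * (\<mu> 1 + \<mu> 2) * (\<mu>' 1 + \<mu>' 2)) (at s)"
    by (rule DERIV_cong[OF DERIV_power[OF DERIV_add[OF \<mu>' \<mu>']]]) (simp add: \<mu>_def)
  have "((\<lambda>t. k_value (\<Theta> t) (\<omega> t)) has_real_derivative
      ((\<mu>' 1 * \<mu> 2 + \<mu> 1 * \<mu>' 2) * (\<mu> 1 + \<mu> 2)^2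
        - \<mu> 1 * \<mu> 2 * (2 * (\<mu> 1 + \<mu> 2) * (\<mu>' 1 + \<mu>' 2))) / ((\<mu> 1 + \<mu> 2)^2 * (\<mu> 1 + \<mu> 2)^2)) (at s)"
    unfolding k_value_def Let_def
    using DERIV_divide[OF num den] sum_pos by (simp add: \<mu>_def)
  from DERIV_unique[OF this k'] have
    "(\<mu>' 1 * \<mu> 2 + \<mu> 1 * \<mu>' 2) * (\<mu> 1 + \<mu> 2)^2
        - \<mu> 1 * \<mu> 2 * (2 * (\<mu> 1 + \<mu> 2) * (\<mu>' 1 + \<mu>' 2)) = 0"
    using sum_pos by simp
  moreover have "(\<mu>' 1 * \<mu> 2 + \<mu> 1 * \<mu>' 2) * (\<mu> 1 + \<mu> 2)^2
        - \<mu> 1 * \<mu> 2 * (2 * (\<mu> 1 + \<mu> 2) * (\<mu>' 1 + \<mu>' 2))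
      = (\<mu> 1 + \<mu> 2) * ((\<mu> 2 - \<mu> 1) * (\<mu>' 1 * \<mu> 2 - \<mu>' 2 * \<mu> 1))"
    by algebra
  ultimately have "\<mu>' 1 * \<mu> 2 = \<mu>' 2 * \<mu> 1" using sum_pos ne by simp
  \<comment> \<open>The common logarithmic derivative of the two momenta.\<close>
  define c where "c = \<mu>' 1 / \<mu> 1"
  have c: "\<mu>' 1 = c * \<mu> 1" "\<mu>' 2 = c * \<mu> 2"
    using \<open>\<mu>' 1 * \<mu> 2 = \<mu>' 2 * \<mu> 1\<close> pos[of 1] by (simp_all add: c_def field_simps)
  have H: "2 * H = - (\<omega> s 1 * \<mu> 1 + \<omega> s 2 * \<mu> 2)"
    using virial by (simp add: H_def energy_def \<mu>_def power2_eq_square algebra_simps)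
  have "((\<lambda>t. h_value m (T t) (\<Theta> t) (\<omega> t)) has_real_derivative
      (\<omega> s 1 * \<mu>' 1 + \<omega> s 2 * \<mu>' 2) * (\<mu> 1 + \<mu> 2)^2 + (2 * H) * ((\<mu> 1 + \<mu> 2) * (\<mu>' 1 + \<mu>' 2))) (at s)"
    unfolding h_value_def Let_def
    by (rule DERIV_cong[OF DERIV_mult[OF H' den]]) (simp add: \<mu>_def H_def)
  also have "(\<omega> s 1 * \<mu>' 1 + \<omega> s 2 * \<mu>' 2) * (\<mu> 1 + \<mu> 2)^2 + (2 * H) * ((\<mu> 1 + \<mu> 2) * (\<mu>' 1 + \<mu>' 2)) = 0"
    unfolding H c by algebra
  finally show ?thesis using k' by (simp add: cusp_at_def)
qed

section \<open>The families of balanced triangles\<close>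

lemma smooth_on_differentiable:
  assumes "smooth_on I f" "s \<in> I"
  shows "f differentiable (at s)"
proof -
  from assms obtain D where "(f has_vector_derivative D) (at s)"
    unfolding smooth_on_def by metis
  then show ?thesis by (rule differentiableI_vector)
qed

theorem proposition16:
  fixes m :: "3 \<Rightarrow> real"
    and \<gamma> :: "3 \<Rightarrow> real \<Rightarrow> real^3"
    and \<xi> :: "3 \<Rightarrow> real \<Rightarrow> 3 \<Rightarrow> real^2"
    and e :: "3 \<Rightarrow> real \<Rightarrow> 2 \<Rightarrow> real^2"
    and \<Theta> \<omega> :: "3 \<Rightarrow> real \<Rightarrow> 2 \<Rightarrow> real"
    and h k :: "3 \<Rightarrow> real \<Rightarrow> real"
  assumes masses: "\<And>i. 0 < m i"
    and families: "three_families m \<gamma>"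
    and equilibria: "\<And>j. equilibria_along m (\<gamma> j) (\<xi> j) (e j) (\<Theta> j) (\<omega> j)"
    and h_def: "\<And>j s. h j s = h_value m (\<gamma> j s) (\<Theta> j s) (\<omega> j s)"
    and k_def: "\<And>j s. k j s = k_value (\<Theta> j s) (\<omega> j s)"
  shows "\<forall>j. (\<exists>s\<in>{0<..<1}. cusp_at (h j) (k j) s) \<or> (\<exists>s\<in>{0<..<1}. k j s = 1/4)"
proof
  fix j
  let ?I = "{0<..<1} :: real set"
  define x where "x = (\<lambda>s i p. \<xi> j s i \<bullet> e j s p)"
  have tri: "true_triangle (\<gamma> j s)" if "s \<in> ?I" for s
  proof -
    have "\<exists>j'. \<exists>s'\<in>?I. \<exists>r>0. \<gamma> j s = r *\<^sub>R \<gamma> j' s'"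
      using that by (intro exI[of _ j] bexI[of _ s] exI[of _ 1]) auto
    then show ?thesis
      using families unfolding three_families_def balanced_true_triangle_def by blast
  qed
  have bal: "balanced_coordinates m (x s) (\<gamma> j s) (\<Theta> j s) (\<omega> j s)" if "s \<in> ?I" for s
    unfolding x_def
    using equilibria[of j] that
    by (intro balanced_coordinates_of_equilibrium masses tri) (auto simp: equilibria_along_def)
  have diff: "(\<lambda>s. x s i p) differentiable (at s)" if "s \<in> ?I" for s i p
    unfolding x_def
    using equilibria[of j] that
    by (intro differentiable_inner smooth_on_differentiable[of ?I]) (auto simp: equilibria_along_def)
  have variation: "\<exists>\<mu>'. (\<forall>p. ((\<lambda>t. \<Theta> j t p * \<omega> j t p) has_real_derivative \<mu>' p) (at s)) \<and>
      ((\<lambda>t. energy m (\<gamma> j t) (\<Theta> j t) (\<omega> j t)) has_real_derivative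
        \<omega> j s 1 * \<mu>' 1 + \<omega> j s 2 * \<mu>' 2) (at s)" if "s \<in> ?I" for s
    by (rule first_variation[of ?I s m x "\<gamma> j" "\<Theta> j" "\<omega> j"]) (use that bal diff in auto)
  have k_diff: "\<exists>D. (k j has_real_derivative D) (at s)" if s: "s \<in> ?I" for s
  proof -
    interpret balanced_coordinates m "x s" "\<gamma> j s" "\<Theta> j s" "\<omega> j s" using bal[OF s] .
    obtain \<mu>' where \<mu>': "\<And>p. ((\<lambda>t. \<Theta> j t p * \<omega> j t p) has_real_derivative \<mu>' p) (at s)"
      using variation[OF s] by blast
    have "0 < \<Theta> j s 1 * \<omega> j s 1 + \<Theta> j s 2 * \<omega> j s 2"
      by (intro add_pos_pos mult_pos_pos moment_pos freq_pos)
    then show ?thesis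
      unfolding k_def[abs_def] k_value_def Let_def
      by (intro exI) (rule derivative_eq_intros \<mu>' refl | simp)+
  qed
  obtain E :: "3 \<times> bool \<Rightarrow> real^3" where E: "bij_betw E UNIV (end_points m)"
    and ends: "((\<lambda>s. unit_size (\<gamma> j s)) \<longlongrightarrow> E (j, False)) (at_right 0)"
      "((\<lambda>s. unit_size (\<gamma> j s)) \<longlongrightarrow> E (j, True)) (at_left 1)"
    using families unfolding three_families_def by blast
  obtain C where C: "\<And>x T \<Theta> \<omega>. balanced_coordinates m x T \<Theta> \<omega> \<Longrightarrow>
      (k_value \<Theta> \<omega>)^2 \<le> C * sqrt (sixteen_area_squared (unit_size T))"
    using k_value_bound[of m] masses by blast
  have k_end: "(k j \<longlongrightarrow> 0) F"
    if F: "\<forall>\<^sub>F s in F. s \<in> ?I" "((\<lambda>s. unit_size (\<gamma> j s)) \<longlongrightarrow> E z) F" for F z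
  proof -
    have flat: "sixteen_area_squared (E z) = 0"
      using E by (intro end_points_flat[of _ m]) (auto simp: bij_betw_def)
    have "((\<lambda>s. sixteen_area_squared (unit_size (\<gamma> j s))) \<longlongrightarrow> sixteen_area_squared (E z)) F"
      unfolding sixteen_area_squared_def by (intro tendsto_intros F(2))
    then have upper: "((\<lambda>s. C * sqrt (sixteen_area_squared (unit_size (\<gamma> j s)))) \<longlongrightarrow> C * sqrt 0) F"
      unfolding flat by (intro tendsto_intros)
    have "((\<lambda>s. (k j s)^2) \<longlongrightarrow> 0) F"
    proof (rule tendsto_sandwich[OF _ _ tendsto_const, rotated 2])
      show "\<forall>\<^sub>F s in F. (k j s)^2 \<le> C * sqrt (sixteen_area_squared (unit_size (\<gamma> j s)))"
        using F(1) unfolding k_def by (rule eventually_mono) (rule C[OF bal])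
    qed (use upper in simp_all)
    then have "((\<lambda>s. sqrt ((k j s)^2)) \<longlongrightarrow> sqrt 0) F" by (rule tendsto_real_sqrt)
    then show ?thesis by (simp add: tendsto_rabs_zero_iff)
  qed
  have "\<exists>s\<in>?I. \<forall>t\<in>?I. k j t \<le> k j s"
  proof (rule interior_maximum)
    show "continuous_on ?I (k j)"
      using k_diff DERIV_isCont by (intro continuous_at_imp_continuous_on) blast
    show "0 < k j s" if "s \<in> ?I" for s
      unfolding k_def by (rule balanced_coordinates.k_pos[OF bal[OF that]])
    show "(k j \<longlongrightarrow> 0) (at_right 0)"
      by (rule k_end[OF _ ends(1)]) (auto simp: eventually_at_right_field intro!: exI[of _ 1])
    show "(k j \<longlongrightarrow> 0) (at_left 1)"
      by (rule k_end[OF _ ends(2)]) (auto simp: eventually_at_left_field intro!: exI[of _ 0])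
  qed
  then obtain s where s: "s \<in> ?I" and max: "\<And>t. t \<in> ?I \<Longrightarrow> k j t \<le> k j s" by blast
  obtain D where D: "(k j has_real_derivative D) (at s)" using k_diff[OF s] by blast
  have near: "t \<in> ?I" if "\<bar>s - t\<bar> < min s (1 - s)" for t
    using that by (auto simp: abs_if split: if_splits)
  have "D = 0"
  proof (rule DERIV_local_max[OF D])
    show "0 < min s (1 - s)" using s by simp
    show "\<forall>t. \<bar>s - t\<bar> < min s (1 - s) \<longrightarrow> k j t \<le> k j s" by (intro allI impI max near)
  qed
  have "cusp_at (h j) (k j) s" if "k j s \<noteq> 1/4"
  proof -
    obtain \<mu>' where \<mu>': "\<forall>p. ((\<lambda>t. \<Theta> j t p * \<omega> j t p) has_real_derivative \<mu>' p) (at s)"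
      and H': "((\<lambda>t. energy m (\<gamma> j t) (\<Theta> j t) (\<omega> j t)) has_real_derivative
        \<omega> j s 1 * \<mu>' 1 + \<omega> j s 2 * \<mu>' 2) (at s)"
      using variation[OF s] by (elim exE conjE) (rule that; assumption)
    have hj: "h j = (\<lambda>t. h_value m (\<gamma> j t) (\<Theta> j t) (\<omega> j t))"
      and kj: "k j = (\<lambda>t. k_value (\<Theta> j t) (\<omega> j t))"
      by (rule ext, rule h_def, rule ext, rule k_def)
    show ?thesis
      unfolding hj kj
      by (rule cusp_at_stationary_k[where T = "\<gamma> j" and \<Theta> = "\<Theta> j" and \<omega> = "\<omega> j", OF bal[OF s] spec[OF \<mu>'] H'])
        (use D that in \<open>simp_all only: \<open>D = 0\<close> kj not_False_eq_True\<close>)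
  qed
  then show "(\<exists>s\<in>?I. cusp_at (h j) (k j) s) \<or> (\<exists>s\<in>?I. k j s = 1/4)"
    using s by blast
qed

end
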